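(* Let $a<b$ be real numbers, let $q\in(0,1)$, let $f:[a,b]\to\mathbb{R}$ be a continuous function, and let $x,y\in(a,b]$ be such that $y=a+q^n(x-a)$ for some integer $n\ge 0$. Then there exists some $c\in[y,x]$ such that $$f(x)-f(y)=D_q^a f(c)\,(x-y).$$
   Context: For $f:[a,b]\to\mathbb{R}$ and $q\in(0,1)$, the (shifted) $q$-derivative of $f$ at $x\in(a,b]$ is $$D_q^a f(x)=\frac{f(x)-f(a+q(x-a))}{(1-q)(x-a)}.$$ *)

theory Defs
  imports Complex_Main
begin

(* The q-derivative based at a. It is meaningful for a < x and 0 < q < 1; at x = a the
   value is 0 by the convention on division by zero. For x in {a<..b} it only evaluates
   f inside {a..b}, so f may be a total function considered on {a..b}. *)
definition q_deriv :: "real \<Rightarrow> real \<Rightarrow> (real \<Rightarrow> real) \<Rightarrow> real \<Rightarrow> real" where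
  "q_deriv q a f x = (f x - f (a + q * (x - a))) / ((1 - q) * (x - a))"

end

(* Along the geometric sequence s k = a + q^k (x - a), the difference f x - f y telescopes into
   the sum of the q-derivatives at s k times the step lengths s k - s (k+1), so the difference
   quotient is a weighted mean of q-derivatives at points of [y, x]. The q-derivative is
   continuous on [y, x] because y > a, hence it attains this mean. *)
theory Submission
  imports Defs
begin

text \<open>The denominator \<open>(1 - q) * (t - a)\<close> is the signed step from
  \<open>a + q * (t - a)\<close> to \<open>t\<close>, and the hypotheses make it nonzero.\<close>

lemma q_deriv_step:
  fixes a q t :: real
  assumes "q \<noteq> 1" and "t \<noteq> a"
  shows "f t - f (a + q * (t - a)) = q_deriv q a f t * (t - (a + q * (t - a)))"
proof -
  have "t - (a + q * (t - a)) = (1 - q) * (t - a)"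
    by (simp add: algebra_simps)
  then show ?thesis
    using assms by (simp add: q_deriv_def)
qed

text \<open>The map sending \<open>t\<close> to \<open>a + q * (t - a)\<close> pulls points towards
  \<open>a\<close>: it may leave \<open>{y..b}\<close> but stays in \<open>{a..b}\<close>, where
  \<open>f\<close> is continuous. Since \<open>a < y\<close>, the denominator has no zero on
  \<open>{y..b}\<close>.\<close>

lemma continuous_on_q_deriv:
  fixes a b q y :: real
  assumes "0 \<le> q" and "q < 1" and "continuous_on {a..b} f" and "a < y"
  shows "continuous_on {y..b} (q_deriv q a f)"
proof -
  have "a + q * (t - a) \<in> {a..b}" if "t \<in> {y..b}" for t
  proof -
    have "q * (t - a) \<le> 1 * (t - a)" and "0 \<le> q * (t - a)"
      using assms that by (auto intro!: mult_right_mono)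
    then show ?thesis
      using that by auto
  qed
  then have "continuous_on {y..b} (\<lambda>t. f (a + q * (t - a)))"
    by (intro continuous_on_compose2[OF assms(3)] continuous_intros) auto
  moreover have "continuous_on {y..b} f"
    using assms(4) by (intro continuous_on_subset[OF assms(3)]) auto
  ultimately show ?thesis
    unfolding q_deriv_def using assms by (intro continuous_intros) auto
qed

text \<open>With positive weights, the mean \<open>m\<close> can lie neither strictly below nor
  strictly above all the values \<open>h (s k)\<close>. It thus lies between two of them, and the
  intermediate value theorem, in the form of connectedness of the image, applies.\<close>

lemma weighted_mean_attained:
  fixes h :: "real \<Rightarrow> real" and s w :: "nat \<Rightarrow> real"
  assumes "continuous_on {u..v} h"
    and "\<And>k. k < n \<Longrightarrow> s k \<in> {u..v}" and "\<And>k. k < n \<Longrightarrow> 0 < w k" and "0 < n"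
  shows "\<exists>c\<in>{u..v}. (\<Sum>k<n. h (s k) * w k) = h c * (\<Sum>k<n. w k)"
proof -
  define W where "W = (\<Sum>k<n. w k)"
  define m where "m = (\<Sum>k<n. h (s k) * w k) / W"
  \<comment> \<open>Nonemptiness makes \<open>W\<close> positive and the termwise comparisons of
    sums below strict.\<close>
  have ne: "{..<n} \<noteq> {}"
    using assms(4) by auto
  have "0 < W"
    unfolding W_def using assms(3) ne by (intro sum_pos) auto
  then have m: "(\<Sum>k<n. h (s k) * w k) = m * W"
    by (simp add: m_def)
  have "\<exists>i<n. h (s i) \<le> m"
  proof (rule ccontr)
    assume "\<not> ?thesis"
    then have "(\<Sum>k<n. m * w k) < (\<Sum>k<n. h (s k) * w k)"
      using assms(3) ne by (intro sum_strict_mono) auto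
    then show False
      using m by (simp add: W_def sum_distrib_left)
  qed
  moreover have "\<exists>j<n. m \<le> h (s j)"
  proof (rule ccontr)
    assume "\<not> ?thesis"
    then have "(\<Sum>k<n. h (s k) * w k) < (\<Sum>k<n. m * w k)"
      using assms(3) ne by (intro sum_strict_mono) auto
    then show False
      using m by (simp add: W_def sum_distrib_left)
  qed
  moreover have "connected (h ` {u..v})"
    using assms(1) by (intro connected_continuous_image connected_Icc)
  ultimately obtain i j where "connected (h ` {u..v})" "i < n" "h (s i) \<le> m" "j < n" "m \<le> h (s j)"
    by blast
  then have "m \<in> h ` {u..v}"
    using connectedD_interval[of "h ` {u..v}" "h (s i)" "h (s j)" m] assms(2) by simp
  then show ?thesis
    using m by (auto simp: W_def)
qed

theorem theorem7:
  fixes a b q x y :: real and f :: "real \<Rightarrow> real"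
  assumes "a < b"
    and "q \<in> {0<..<1}"
    and "continuous_on {a..b} f"
    and "x \<in> {a<..b}" and "y \<in> {a<..b}"
    and "\<exists>n::nat. y = a + q ^ n * (x - a)"
  shows "\<exists>c\<in>{y..x}. f x - f y = q_deriv q a f c * (x - y)"
proof -
  from assms(6) obtain n :: nat where n: "y = a + q ^ n * (x - a)"
    by blast
  show ?thesis
  \<comment> \<open>For \<open>n = 0\<close> the points \<open>x\<close> and \<open>y\<close>
    coincide, so \<open>c = x\<close> works with both sides zero; the mean over an empty sum would
    be undefined.\<close>
  proof (cases "n = 0")
    case True
    then show ?thesis
      using n by auto
  next
    case False
    have q: "0 < q" "q < 1" and x: "a < x" "x \<le> b" and y: "a < y"
      using assms by auto
    define s where "s k = a + q ^ k * (x - a)" for k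
    have s_Suc: "s (Suc k) = a + q * (s k - a)" for k
      by (simp add: s_def)
    have s_gt: "a < s k" for k
      using q x by (simp add: s_def)
    have s_step: "s (Suc k) < s k" for k
      using q x by (simp add: s_def)
    have s0: "s 0 = x" and sn: "s n = y"
      by (simp_all add: s_def n)
    have s_anti: "s j \<le> s i" if "i \<le> j" for i j
      using lift_Suc_antimono_le[of s, OF less_imp_le[OF s_step] that] .
    have s_in: "s k \<in> {y..x}" if "k < n" for k
      using that s_anti[of 0 k] s_anti[of k n] s0 sn by auto
    have cont: "continuous_on {y..x} (q_deriv q a f)"
      using q assms(3) y x(2)
      by (intro continuous_on_subset[OF continuous_on_q_deriv[of q a b f y]]) auto
    \<comment> \<open>Stated for arbitrary \<open>g\<close> to serve twice: \<open>g = f\<close>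
      gives the increment of \<open>f\<close>, and the identity gives the total weight
      \<open>x - y\<close>.\<close>
    have tele: "(\<Sum>k<n. g (s k) - g (s (Suc k))) = g x - g y" for g :: "real \<Rightarrow> real"
      using sum_lessThan_telescope'[of "\<lambda>k. g (s k)" n] s0 sn by simp
    have "f (s k) - f (s (Suc k)) = q_deriv q a f (s k) * (s k - s (Suc k))" for k
      using q_deriv_step[of q "s k" a f] q s_gt[of k] by (simp add: s_Suc)
    then have "f x - f y = (\<Sum>k<n. q_deriv q a f (s k) * (s k - s (Suc k)))"
      using tele[of f] by simp
    \<comment> \<open>The weights are the step lengths, positive because \<open>s\<close> is
      strictly decreasing.\<close>
    moreover have "\<exists>c\<in>{y..x}. (\<Sum>k<n. q_deriv q a f (s k) * (s k - s (Suc k)))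
        = q_deriv q a f c * (\<Sum>k<n. s k - s (Suc k))"
      using cont s_in s_step False by (intro weighted_mean_attained) auto
    ultimately show ?thesis
      using tele[of "\<lambda>t. t"] by simp
  qed
qed

end
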